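(* Let $f=\omega\circ h\colon X\to\mathbb C^p$ be a quasi-reflection map. Then $f$ has normal crossings if and only if $h$ has orbit normal crossings (by $G$) and $h$ is one-to-orbit over $\mathscr A$ (by $G$).
   Context: Let $V$ be a $p$-dimensional complex vector space with a fixed positive definite hermitian form. A reflection on $V$ is a unitary linear map of finite order whose fixed space (its reflecting hyperplane) has dimension $\dim V-1$. A reflection group is a finite subgroup $G\le\mathrm U(V)$ generated by reflections. $\mathscr A\subset V$ is the union of the reflecting hyperplanes of all reflections in $G$. By Shephard--Todd, $\mathbb C[V]^G$ is generated by $p$ homogeneous algebraically independent polynomials $\omega_1,\dots,\omega_p$; the orbit map of $G$ is $\omega=(\omega_1,\dots,\omega_p)\colon V\to\mathbb C^p$. A quasi-reflection map is a composite $f=\omega\circ h\colon X\to\mathbb C^p$, where $X$ is a complex manifold, $h\colon X\to V$ is a finite holomorphic map and $\omega$ is the orbit map of a reflection group $G$ on $V$. For a set $Z$ and $k\ge2$ let $\Delta(Z,k)=\{(z^{(1)},\dots,z^{(k)})\in Z^k\mid z^{(1)}=\dots=z^{(k)}\}$ and $Z^{(k)}=\{(z^{(1)},\dots,z^{(k)})\in Z^k\mid z^{(i)}\ne z^{(j)}\text{ for all }i\neq j\}$. A map $f\colon X\to Y$ of complex manifolds has normal crossings if, for every $k\ge2$, the restriction of $f\times\dots\times f$ ($k$ factors) to $X^{(k)}$ is transverse to $\Delta(Y,k)$. A map $h\colon X\to V$ has orbit normal crossings (by $G$) if, for every $k\ge2$ and every $(g_1,\dots,g_k)\in G^k$, the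 restriction of $g_1h\times\dots\times g_kh$ to $X^{(k)}$ is transverse to $\Delta(V,k)$, where $(gh)(x)=g(h(x))$. A map $h\colon X\to V$ is one-to-orbit over $\mathscr A$ (by $G$) if the restriction of $\omega\circ h$ to $h^{-1}(\mathscr A)$ is one-to-one. *)

theory Defs
  imports "HOL-Analysis.Analysis" "HOL-Algebra.Generated_Groups"
begin

section \<open>Reflection groups and orbit maps\<close>

text \<open>The \<open>p\<close>-dimensional space \<open>V\<close> is \<^typ>\<open>complex^'p\<close> (a choice of linear coordinates), carrying an
  arbitrary positive definite hermitian form \<open>H\<close>.  Complex scalar multiplication is \<open>*s\<close>;
  \<open>vec.dim\<close>, \<open>vec.subspace\<close> are the notions over the field \<^typ>\<open>complex\<close>.\<close>

abbreviation clinear_map :: "(complex^'m \<Rightarrow> complex^'q) \<Rightarrow> bool" where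
  "clinear_map \<equiv> Vector_Spaces.linear (*s) (*s)"

definition pos_def_hermitian :: "(complex^'p \<Rightarrow> complex^'p \<Rightarrow> complex) \<Rightarrow> bool" where
  "pos_def_hermitian H \<longleftrightarrow>
     (\<forall>u v w. H (u + v) w = H u w + H v w) \<and>
     (\<forall>c u w. H (c *s u) w = c * H u w) \<and>
     (\<forall>u w. H w u = cnj (H u w)) \<and>
     (\<forall>u. u \<noteq> 0 \<longrightarrow> 0 < Re (H u u))"

definition unitary_map ::
    "(complex^'p \<Rightarrow> complex^'p \<Rightarrow> complex) \<Rightarrow> (complex^'p \<Rightarrow> complex^'p) \<Rightarrow> bool" where
  "unitary_map H g \<longleftrightarrow> clinear_map g \<and> (\<forall>u v. H (g u) (g v) = H u v)"

definition unitary_group ::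
    "(complex^'p \<Rightarrow> complex^'p \<Rightarrow> complex) \<Rightarrow> (complex^'p \<Rightarrow> complex^'p) monoid" where
  "unitary_group H = \<lparr>carrier = {g. unitary_map H g}, monoid.mult = (\<circ>), one = id\<rparr>"

definition fixed_space :: "(complex^'p \<Rightarrow> complex^'p) \<Rightarrow> (complex^'p) set" where
  "fixed_space g = {v. g v = v}"

definition is_reflection ::
    "(complex^'p \<Rightarrow> complex^'p \<Rightarrow> complex) \<Rightarrow> (complex^'p \<Rightarrow> complex^'p) \<Rightarrow> bool" where
  "is_reflection H r \<longleftrightarrow>
     unitary_map H r \<and> (\<exists>n\<ge>1. r ^^ n = id) \<and> vec.dim (fixed_space r) + 1 = CARD('p)"

definition reflection_group ::
    "(complex^'p \<Rightarrow> complex^'p \<Rightarrow> complex) \<Rightarrow> (complex^'p \<Rightarrow> complex^'p) set \<Rightarrow> bool" where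
  "reflection_group H G \<longleftrightarrow>
     subgroup G (unitary_group H) \<and> finite G \<and>
     (\<exists>R \<subseteq> {r. is_reflection H r}. G = generate (unitary_group H) R)"

definition arrangement ::
    "(complex^'p \<Rightarrow> complex^'p \<Rightarrow> complex) \<Rightarrow> (complex^'p \<Rightarrow> complex^'p) set \<Rightarrow> (complex^'p) set" where
  "arrangement H G = (\<Union>r \<in> {r \<in> G. is_reflection H r}. fixed_space r)"

text \<open>Polynomials are represented by the functions they define, which is harmless since
  \<^typ>\<open>complex\<close> is infinite.\<close>

inductive polynomial_fun :: "(complex^'p \<Rightarrow> complex) \<Rightarrow> bool" where
  const: "polynomial_fun (\<lambda>_. c)"
| coord: "polynomial_fun (\<lambda>v. v $ i)"
| add: "polynomial_fun P \<Longrightarrow> polynomial_fun Q \<Longrightarrow> polynomial_fun (\<lambda>v. P v + Q v)"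
| mult: "polynomial_fun P \<Longrightarrow> polynomial_fun Q \<Longrightarrow> polynomial_fun (\<lambda>v. P v * Q v)"

definition invariant_polynomials ::
    "(complex^'p \<Rightarrow> complex^'p) set \<Rightarrow> (complex^'p \<Rightarrow> complex) set" where
  "invariant_polynomials G = {P. polynomial_fun P \<and> (\<forall>g\<in>G. \<forall>v. P (g v) = P v)}"

text \<open>The components of \<open>\<omega>\<close> are homogeneous, algebraically independent, and generate the algebra of
  invariants.\<close>

definition orbit_map ::
    "(complex^'p \<Rightarrow> complex^'p) set \<Rightarrow> (complex^'p \<Rightarrow> complex^'p) \<Rightarrow> bool" where
  "orbit_map G \<omega> \<longleftrightarrow>
     (\<forall>i. (\<lambda>v. \<omega> v $ i) \<in> invariant_polynomials G) \<and>
     (\<forall>i. \<exists>d::nat. \<forall>c v. \<omega> (c *s v) $ i = c ^ d * \<omega> v $ i) \<and>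
     (\<forall>Q. polynomial_fun Q \<and> (\<forall>v. Q (\<omega> v) = 0) \<longrightarrow> (\<forall>y. Q y = 0)) \<and>
     (\<forall>P \<in> invariant_polynomials G. \<exists>Q. polynomial_fun Q \<and> (\<forall>v. P v = Q (\<omega> v)))"


section \<open>Complex manifolds and holomorphic maps\<close>

text \<open>Charts take values in a complex linear subspace \<open>E\<close> of \<^typ>\<open>complex^'m\<close>; this allows every
  dimension \<open>n \<ge> 0\<close>, whereas \<^typ>\<open>complex^'m\<close> itself always has positive dimension.\<close>

type_synonym ('a, 'm) chart = "'a set \<times> ('a \<Rightarrow> complex^'m)"

definition holomorphic_within :: "(complex^'m \<Rightarrow> complex^'q) \<Rightarrow> (complex^'m) set \<Rightarrow> bool" where
  "holomorphic_within g S \<longleftrightarrow>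
     (\<forall>z\<in>S. \<exists>D. clinear_map D \<and> (g has_derivative D) (at z within S))"

definition complex_chart :: "'a topology \<Rightarrow> (complex^'m) set \<Rightarrow> ('a, 'm) chart \<Rightarrow> bool" where
  "complex_chart X E = (\<lambda>(U, \<phi>).
     openin X U \<and> openin (top_of_set E) (\<phi> ` U) \<and>
     homeomorphic_map (subtopology X U) (top_of_set (\<phi> ` U)) \<phi>)"

definition complex_manifold ::
    "'a topology \<Rightarrow> (complex^'m) set \<Rightarrow> ('a, 'm) chart set \<Rightarrow> bool" where
  "complex_manifold X E A \<longleftrightarrow>
     Hausdorff_space X \<and> second_countable X \<and> vec.subspace E \<and>
     (\<forall>c\<in>A. complex_chart X E c) \<and> (\<Union>c\<in>A. fst c) = topspace X \<and>
     (\<forall>(U, \<phi>)\<in>A. \<forall>(W, \<psi>)\<in>A. holomorphic_within (\<psi> \<circ> inv_into U \<phi>) (\<phi> ` (U \<inter> W)))"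

definition holomorphic_map :: "('a, 'm::finite) chart set \<Rightarrow> ('a \<Rightarrow> complex^'q) \<Rightarrow> bool" where
  "holomorphic_map A f \<longleftrightarrow> (\<forall>(U, \<phi>)\<in>A. holomorphic_within (f \<circ> inv_into U \<phi>) (\<phi> ` U))"

definition finite_map :: "'a topology \<Rightarrow> ('a \<Rightarrow> complex^'q) \<Rightarrow> bool" where
  "finite_map X f \<longleftrightarrow>
     continuous_map X euclidean f \<and> proper_map X euclidean f \<and>
     (\<forall>y. finite {x \<in> topspace X. f x = y})"

text \<open>The map \<open>f = \<omega> \<circ> h\<close> is the quasi-reflection map determined by the following data.\<close>

definition quasi_reflection_data ::
    "'a topology \<Rightarrow> (complex^'m) set \<Rightarrow> ('a, 'm) chart set \<Rightarrow>
     (complex^'p \<Rightarrow> complex^'p \<Rightarrow> complex) \<Rightarrow> (complex^'p \<Rightarrow> complex^'p) set \<Rightarrow>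
     (complex^'p \<Rightarrow> complex^'p) \<Rightarrow> ('a \<Rightarrow> complex^'p) \<Rightarrow> bool" where
  "quasi_reflection_data X E A H G \<omega> h \<longleftrightarrow>
     complex_manifold X E A \<and> pos_def_hermitian H \<and> reflection_group H G \<and> orbit_map G \<omega> \<and>
     holomorphic_map A h \<and> finite_map X h"


section \<open>Transversality to the diagonal\<close>

text \<open>Elements of \<open>Z\<^sup>k\<close> are extensional functions on \<open>{..<k}\<close>.\<close>

definition small_diagonal :: "'z set \<Rightarrow> nat \<Rightarrow> (nat \<Rightarrow> 'z) set" where
  "small_diagonal Z k = {z \<in> {..<k} \<rightarrow>\<^sub>E Z. \<forall>i<k. \<forall>j<k. z i = z j}"

definition distinct_tuples :: "'z set \<Rightarrow> nat \<Rightarrow> (nat \<Rightarrow> 'z) set" where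
  "distinct_tuples Z k = {z \<in> {..<k} \<rightarrow>\<^sub>E Z. \<forall>i<k. \<forall>j<k. i \<noteq> j \<longrightarrow> z i \<noteq> z j}"

definition product_map :: "nat \<Rightarrow> (nat \<Rightarrow> 'a \<Rightarrow> 'b) \<Rightarrow> (nat \<Rightarrow> 'a) \<Rightarrow> (nat \<Rightarrow> 'b)" where
  "product_map k F x = (\<lambda>i\<in>{..<k}. F i (x i))"

text \<open>Product charts form an atlas of \<open>X\<^sup>k\<close>, with model space \<open>E\<^sup>k\<close>.  In the product of the charts
  \<open>c i\<close> around \<open>x i\<close>, the differential at \<open>x\<close> of a holomorphic map \<open>\<Phi>\<close> from \<open>X\<^sup>k\<close> to
  \<open>(\<complex>\<^sup>q)\<^sup>k\<close> sends a tangent vector \<open>u \<in> E\<^sup>k\<close> to the derivative of \<open>\<Phi>\<close> at \<open>t = 0\<close> along the curve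
  whose coordinate expression is \<open>t \<mapsto> x + t u\<close>.  Only the germ of this curve at \<open>t = 0\<close> matters,
  so it is irrelevant that it leaves the chart for large \<open>t\<close>.\<close>

definition chart_curve ::
    "nat \<Rightarrow> (nat \<Rightarrow> ('a, 'm) chart) \<Rightarrow> (nat \<Rightarrow> 'a) \<Rightarrow> (nat \<Rightarrow> complex^'m) \<Rightarrow> real \<Rightarrow> (nat \<Rightarrow> 'a)" where
  "chart_curve k c x u t =
     (\<lambda>i\<in>{..<k}. inv_into (fst (c i)) (snd (c i)) (snd (c i) (x i) + t *\<^sub>R u i))"

definition differential ::
    "nat \<Rightarrow> (nat \<Rightarrow> ('a, 'm) chart) \<Rightarrow> ((nat \<Rightarrow> 'a) \<Rightarrow> (nat \<Rightarrow> complex^'q)) \<Rightarrow> (nat \<Rightarrow> 'a) \<Rightarrow>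
     (nat \<Rightarrow> complex^'m) \<Rightarrow> (nat \<Rightarrow> complex^'q)" where
  "differential k c \<Phi> x u =
     (\<lambda>i\<in>{..<k}. vector_derivative (\<lambda>t. \<Phi> (chart_curve k c x u t) i) (at 0))"

text \<open>Transversality, on an open subset \<open>M\<close> of \<open>X\<^sup>k\<close>, of a map \<open>\<Phi>\<close> to the diagonal of
  \<open>(\<complex>\<^sup>q)\<^sup>k\<close>: at each point of \<open>M\<close> mapped into the diagonal, the image of the differential and the
  tangent space of the diagonal (which is the diagonal itself, a linear subspace) together span
  \<open>(\<complex>\<^sup>q)\<^sup>k\<close>.\<close>

definition transverse_to_diagonal ::
    "(complex^'m) set \<Rightarrow> ('a, 'm) chart set \<Rightarrow> nat \<Rightarrow> (nat \<Rightarrow> 'a) set \<Rightarrow>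
     ((nat \<Rightarrow> 'a) \<Rightarrow> (nat \<Rightarrow> complex^'q)) \<Rightarrow> bool" where
  "transverse_to_diagonal E A k M \<Phi> \<longleftrightarrow>
     (\<forall>x\<in>M. \<Phi> x \<in> small_diagonal UNIV k \<longrightarrow>
       (\<forall>c. (\<forall>i<k. c i \<in> A \<and> x i \<in> fst (c i)) \<longrightarrow>
         {\<lambda>i\<in>{..<k}. a i + b i | a b.
            a \<in> differential k c \<Phi> x ` ({..<k} \<rightarrow>\<^sub>E E) \<and> b \<in> small_diagonal UNIV k}
         = ({..<k} \<rightarrow>\<^sub>E UNIV)))"

definition normal_crossings ::
    "'a topology \<Rightarrow> (complex^'m) set \<Rightarrow> ('a, 'm) chart set \<Rightarrow> ('a \<Rightarrow> complex^'q) \<Rightarrow> bool" where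
  "normal_crossings X E A f \<longleftrightarrow>
     (\<forall>k\<ge>2. transverse_to_diagonal E A k (distinct_tuples (topspace X) k)
              (product_map k (\<lambda>_. f)))"

definition orbit_normal_crossings ::
    "'a topology \<Rightarrow> (complex^'m) set \<Rightarrow> ('a, 'm) chart set \<Rightarrow>
     (complex^'p \<Rightarrow> complex^'p) set \<Rightarrow> ('a \<Rightarrow> complex^'p) \<Rightarrow> bool" where
  "orbit_normal_crossings X E A G h \<longleftrightarrow>
     (\<forall>k\<ge>2. \<forall>g \<in> {..<k} \<rightarrow>\<^sub>E G.
        transverse_to_diagonal E A k (distinct_tuples (topspace X) k)
          (product_map k (\<lambda>i. g i \<circ> h)))"

definition one_to_orbit_over ::
    "'a topology \<Rightarrow> (complex^'p \<Rightarrow> complex^'p) \<Rightarrow> (complex^'p) set \<Rightarrow> ('a \<Rightarrow> complex^'p) \<Rightarrow> bool" where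
  "one_to_orbit_over X \<omega> S h \<longleftrightarrow> inj_on (\<omega> \<circ> h) {x \<in> topspace X. h x \<in> S}"

end

theory Submission
  imports Defs "HOL-Complex_Analysis.Great_Picard"
begin

text \<open>
  The theorem compares two conditions at a tuple of \<open>k \<ge> 2\<close> distinct points \<open>x i\<close> with the same image
  under \<open>f = \<omega> \<circ> h\<close>.  The fibres of \<open>\<omega>\<close> are the \<open>G\<close>-orbits (\<open>orbit_map_separates_orbits\<close>), so there are
  \<open>g i \<in> G\<close> with all \<open>g i (h (x i))\<close> equal to one point \<open>v\<close>.  Since \<open>f = \<omega> \<circ> g i \<circ> h\<close>, the differential of
  \<open>f\<close> at \<open>x i\<close> is that of \<open>g i \<circ> h\<close> followed by \<open>d\<omega> v\<close>, the same linear map for every \<open>i\<close>.  Comparing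
  two factors, transversality of \<open>f \<times> \<dots> \<times> f\<close> to the diagonal forces \<open>d\<omega> v\<close> to be onto, hence invertible;
  and an invertible \<open>d\<omega> v\<close> carries transversality back and forth.  So \<open>f \<times> \<dots> \<times> f\<close> is transverse at
  the tuple if and only if \<open>d\<omega> v\<close> is invertible and the product of the maps \<open>g i \<circ> h\<close> is transverse
  there (\<open>orbit_map_transverse_at_iff\<close>).

  It remains to know that \<open>d\<omega> v\<close> is invertible exactly when \<open>v\<close> lies on no reflecting hyperplane.
  One-to-orbit over the arrangement then says that no tuple of distinct points of a fibre of \<open>f\<close> lands
  on the arrangement, and both implications follow.

  On a hyperplane, invariance of \<open>\<omega>\<close> under the reflection makes \<open>d\<omega> v\<close> singular
  (\<open>orbit_map_derivative_not_injective_on_arrangement\<close>).  Off the hyperplanes the classical argument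
  computes the Jacobian determinant or uses Steinberg's theorem that point stabilizers are generated
  by reflections.  Here a shorter path is taken.  Where the stabilizer is trivial, \<open>d\<omega>\<close> is injective,
  since invariants with any prescribed differential exist
  (\<open>orbit_map_derivative_injective_at_free_point\<close>).  Hence off the arrangement the zeros of the Jacobian
  determinant lie in fixed spaces of codimension at least 2, whereas the zeros of a polynomial never
  form a set that thin unless it is empty (\<open>polynomial_fun_no_isolated_zero_on_plane\<close>,
  \<open>orbit_map_derivative_injective_off_arrangement\<close>).
\<close>

section \<open>Polynomial functions\<close>

lemma clinear_map_imp_linear:
  fixes g :: "complex^'m \<Rightarrow> complex^'q"
  assumes "clinear_map g"
  shows "linear g"
proof -
  interpret Vector_Spaces.linear "(*s)" "(*s)" g by fact
  have scaleR: "r *\<^sub>R x = complex_of_real r *s x" for r and x :: "complex^'k"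
    by (simp add: vec_eq_iff scaleR_conv_of_real[where 'a = complex])
  show ?thesis
    by (rule linearI) (simp_all add: add scaleR scale)
qed

lemma polynomial_fun_sum:
  assumes "\<And>i. i \<in> I \<Longrightarrow> polynomial_fun (P i)"
  shows "polynomial_fun (\<lambda>v. \<Sum>i\<in>I. P i v)"
  using assms
  by (induction I rule: infinite_finite_induct) (auto intro: polynomial_fun.intros)

lemma polynomial_fun_prod:
  assumes "\<And>i. i \<in> I \<Longrightarrow> polynomial_fun (P i)"
  shows "polynomial_fun (\<lambda>v. \<Prod>i\<in>I. P i v)"
  using assms
  by (induction I rule: infinite_finite_induct) (auto intro: polynomial_fun.intros)

lemma polynomial_fun_diff:
  assumes "polynomial_fun P" "polynomial_fun Q"
  shows "polynomial_fun (\<lambda>v. P v - Q v)"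
proof -
  have "polynomial_fun (\<lambda>v. P v + (- 1) * Q v)"
    using assms by (intro polynomial_fun.intros)
  then show ?thesis
    by simp
qed

lemma polynomial_fun_compose:
  fixes P :: "complex^'p \<Rightarrow> complex" and F :: "complex^'q \<Rightarrow> complex^'p"
  assumes "polynomial_fun P" "\<And>i. polynomial_fun (\<lambda>v. F v $ i)"
  shows "polynomial_fun (\<lambda>v. P (F v))"
  using assms(1) by induction (auto intro: polynomial_fun.intros assms(2))

lemma polynomial_fun_compose_clinear_map:
  fixes P :: "complex^'p \<Rightarrow> complex" and g :: "complex^'q \<Rightarrow> complex^'p"
  assumes "polynomial_fun P" "clinear_map g"
  shows "polynomial_fun (\<lambda>v. P (g v))"
proof -
  have "g v $ i = (\<Sum>j\<in>UNIV. matrix g $ i $ j * v $ j)" for v i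
    using matrix_works[OF assms(2), of v] by (simp add: matrix_vector_mult_def vec_eq_iff)
  then show ?thesis
    by (intro polynomial_fun_compose[OF assms(1)])
       (auto intro!: polynomial_fun_sum polynomial_fun.intros)
qed

lemma polynomial_fun_det:
  fixes W :: "complex^'p \<Rightarrow> complex^'q^'q"
  assumes "\<And>i j. polynomial_fun (\<lambda>v. W v $ i $ j)"
  shows "polynomial_fun (\<lambda>v. det (W v))"
  unfolding det_def
  by (intro polynomial_fun_sum polynomial_fun.mult polynomial_fun_prod assms polynomial_fun.const)

text \<open>Besides differentiability, what matters later is that the partial derivatives are again
  polynomial: this makes the Jacobian determinant of an orbit map a polynomial function.\<close>

lemma polynomial_fun_has_polynomial_gradient:
  fixes P :: "complex^'p \<Rightarrow> complex"
  assumes "polynomial_fun P"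
  shows "\<exists>D. (\<forall>j. polynomial_fun (D j)) \<and>
           (\<forall>v. (P has_derivative (\<lambda>u. \<Sum>j\<in>UNIV. D j v * u $ j)) (at v))"
  using assms
proof induction
  case (const c)
  show ?case
    by (rule exI[of _ "\<lambda>_ _. 0"]) (auto intro: polynomial_fun.intros)
next
  case (coord i)
  have "(\<Sum>j\<in>UNIV. (if j = i then 1 else 0) * u $ j) = u $ i" for u :: "complex^'p"
    by (simp add: if_distrib[of "\<lambda>c. c * _"] cong: if_cong)
  then show ?case
    by (intro exI[of _ "\<lambda>j _. if j = i then 1 else 0"])
       (auto intro: polynomial_fun.intros bounded_linear.has_derivative[OF bounded_linear_vec_nth])
next
  case (add P Q)
  then obtain D D' where "\<forall>j. polynomial_fun (D j)" "\<forall>j. polynomial_fun (D' j)"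
    and der: "\<And>v. (P has_derivative (\<lambda>u. \<Sum>j\<in>UNIV. D j v * u $ j)) (at v)"
      "\<And>v. (Q has_derivative (\<lambda>u. \<Sum>j\<in>UNIV. D' j v * u $ j)) (at v)"
    by blast
  then show ?case
    using has_derivative_add[OF der]
    by (intro exI[of _ "\<lambda>j v. D j v + D' j v"])
       (auto intro: polynomial_fun.intros simp: ring_distribs sum.distrib)
next
  case (mult P Q)
  then obtain D D' where "\<forall>j. polynomial_fun (D j)" "\<forall>j. polynomial_fun (D' j)"
    and der: "\<And>v. (P has_derivative (\<lambda>u. \<Sum>j\<in>UNIV. D j v * u $ j)) (at v)"
      "\<And>v. (Q has_derivative (\<lambda>u. \<Sum>j\<in>UNIV. D' j v * u $ j)) (at v)"
    by blast
  then show ?case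
    using has_derivative_mult[OF der] mult(1,2)
    by (intro exI[of _ "\<lambda>j v. P v * D' j v + D j v * Q v"])
       (auto intro!: polynomial_fun.intros
             simp: ring_distribs sum.distrib sum_distrib_left sum_distrib_right mult_ac)
qed

lemma polynomial_fun_differentiable:
  assumes "polynomial_fun P"
  obtains P' where "(P has_derivative P') (at v)"
  using polynomial_fun_has_polynomial_gradient[OF assms] by blast

lemma continuous_on_polynomial_fun:
  assumes "polynomial_fun P"
  shows "continuous_on S P"
  by (meson assms continuous_at_imp_continuous_on has_derivative_continuous
      polynomial_fun_differentiable)

lemma holomorphic_on_polynomial_fun_line:
  assumes "polynomial_fun P"
  shows "(\<lambda>s. P (v + s *s a)) holomorphic_on S"
  using assms by induction (auto intro!: holomorphic_intros)

lemma polynomial_map_has_derivative: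
  fixes F :: "complex^'p \<Rightarrow> complex^'q"
  assumes "\<And>i. polynomial_fun (\<lambda>v. F v $ i)"
  shows "\<exists>W :: complex^'p \<Rightarrow> complex^'p^'q. (\<forall>i j. polynomial_fun (\<lambda>v. W v $ i $ j)) \<and>
           (\<forall>v. (F has_derivative (\<lambda>u. W v *v u)) (at v))"
proof -
  have "\<forall>i. \<exists>D. (\<forall>j. polynomial_fun (D j)) \<and>
          (\<forall>v. ((\<lambda>v. F v $ i) has_derivative (\<lambda>u. \<Sum>j\<in>UNIV. D j v * u $ j)) (at v))"
    using polynomial_fun_has_polynomial_gradient[OF assms] by blast
  then obtain D where D: "\<And>i j. polynomial_fun (D i j)"
    and der: "\<And>i v. ((\<lambda>v. F v $ i) has_derivative (\<lambda>u. \<Sum>j\<in>UNIV. D i j v * u $ j)) (at v)"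
    unfolding choice_iff by blast
  define W where "W v = (\<chi> i j. D i j v)" for v
  have "bounded_linear (\<lambda>c. c *s axis i 1 :: complex^'q)" for i
    by (intro linear_conv_bounded_linear[THEN iffD1] linearI)
       (auto simp: vec_eq_iff axis_def scaleR_conv_of_real[where 'a = complex] algebra_simps)
  note axis_der = bounded_linear.has_derivative[OF this]
  have "((\<lambda>v. F v $ i) has_derivative (\<lambda>u. (W v *v u) $ i)) (at v)" for i v
    using der by (simp add: W_def matrix_vector_mult_def)
  then have "((\<lambda>v. \<Sum>i\<in>UNIV. F v $ i *s axis i 1) has_derivative
      (\<lambda>u. \<Sum>i\<in>UNIV. (W v *v u) $ i *s axis i 1)) (at v)" for v
    by (intro has_derivative_sum axis_der)
  then have "(F has_derivative (\<lambda>u. W v *v u)) (at v)" for v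
    by (simp add: basis_expansion)
  moreover have "polynomial_fun (\<lambda>v. W v $ i $ j)" for i j
    by (simp add: W_def D)
  ultimately show ?thesis
    by blast
qed

text \<open>A point outside a finite set \<open>S\<close> differs from each element of \<open>S\<close> in some coordinate; the
  product of the corresponding coordinate differences separates it from \<open>S\<close>.\<close>

lemma polynomial_fun_vanishing_on_finite:
  fixes u :: "complex^'p"
  assumes "finite S" "u \<notin> S"
  obtains q where "polynomial_fun q" "\<And>w. w \<in> S \<Longrightarrow> q w = 0" "q u \<noteq> 0"
proof -
  have "\<forall>w\<in>S. \<exists>i. u $ i \<noteq> w $ i"
    using assms(2) by (metis vec_eq_iff)
  then obtain i where i: "\<And>w. w \<in> S \<Longrightarrow> u $ i w \<noteq> w $ i w"
    by metis
  show thesis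
  proof (rule that[of "\<lambda>x. \<Prod>w\<in>S. x $ i w - w $ i w"])
    show "polynomial_fun (\<lambda>x. \<Prod>w\<in>S. x $ i w - w $ i w)"
      by (intro polynomial_fun_prod polynomial_fun_diff polynomial_fun.intros)
  qed (use assms i in \<open>auto simp: prod_zero_iff\<close>)
qed

section \<open>Orbit maps of finite linear groups\<close>

locale finite_linear_group =
  fixes G :: "(complex^'p \<Rightarrow> complex^'p) set"
  assumes finite_G: "finite G"
    and id_mem: "id \<in> G"
    and comp_mem: "g \<in> G \<Longrightarrow> k \<in> G \<Longrightarrow> g \<circ> k \<in> G"
    and clinear: "g \<in> G \<Longrightarrow> clinear_map g"
    and inj: "g \<in> G \<Longrightarrow> inj g"
begin

text \<open>Closure under composition already yields inverses: on a finite set of injective maps, composition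
  with a member is injective, hence permutes the set.\<close>

lemma comp_left_bij:
  assumes "g \<in> G"
  shows "bij_betw (\<lambda>k. g \<circ> k) G G"
proof -
  have "inj_on (\<lambda>k. g \<circ> k) G"
    using inj[OF assms] by (intro inj_onI) (auto simp: fun_eq_iff dest: injD)
  then show ?thesis
    using comp_mem[OF assms] finite_G by (simp add: bij_betw_def endo_inj_surj image_subset_iff)
qed

lemma inverse_exists:
  assumes "g \<in> G"
  obtains k where "k \<in> G" "g \<circ> k = id" "k \<circ> g = id"
proof -
  obtain k where k: "k \<in> G" "g \<circ> k = id"
    using comp_left_bij[OF assms] id_mem unfolding bij_betw_def by (metis imageE)
  moreover have "k \<circ> g = id"
    using inj[OF assms] k(2) by (metis fun_eq_iff comp_apply id_apply injD)
  ultimately show thesis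
    using that by blast
qed

lemma comp_right_bij:
  assumes "g \<in> G"
  shows "bij_betw (\<lambda>k. k \<circ> g) G G"
proof -
  obtain g' where g': "g' \<in> G" "g \<circ> g' = id" "g' \<circ> g = id"
    using inverse_exists[OF assms] .
  show ?thesis
    by (rule bij_betwI[where g = "\<lambda>k. k \<circ> g'"])
       (use assms g' comp_mem in \<open>auto simp: comp_assoc\<close>)
qed

lemma sum_invariant_polynomial:
  assumes "polynomial_fun Q"
  shows "(\<lambda>v. \<Sum>k\<in>G. Q (k v)) \<in> invariant_polynomials G"
proof -
  have "(\<Sum>k\<in>G. Q (k (g v))) = (\<Sum>k\<in>G. Q (k v))" if "g \<in> G" for g v
    using sum.reindex_bij_betw[OF comp_right_bij[OF that], of "\<lambda>k. Q (k v)"] by simp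
  moreover have "polynomial_fun (\<lambda>v. \<Sum>k\<in>G. Q (k v))"
    by (intro polynomial_fun_sum polynomial_fun_compose_clinear_map[OF assms clinear])
  ultimately show ?thesis
    by (simp add: invariant_polynomials_def)
qed

lemma prod_invariant_polynomial:
  assumes "polynomial_fun Q"
  shows "(\<lambda>v. \<Prod>k\<in>G. Q (k v)) \<in> invariant_polynomials G"
proof -
  have "(\<Prod>k\<in>G. Q (k (g v))) = (\<Prod>k\<in>G. Q (k v))" if "g \<in> G" for g v
    using prod.reindex_bij_betw[OF comp_right_bij[OF that], of "\<lambda>k. Q (k v)"] by simp
  moreover have "polynomial_fun (\<lambda>v. \<Prod>k\<in>G. Q (k v))"
    by (intro polynomial_fun_prod polynomial_fun_compose_clinear_map[OF assms clinear])
  ultimately show ?thesis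
    by (simp add: invariant_polynomials_def)
qed

lemma orbit_map_invariant:
  assumes "orbit_map G \<omega>" "g \<in> G"
  shows "\<omega> (g v) = \<omega> v"
  using assms by (auto simp: orbit_map_def invariant_polynomials_def vec_eq_iff)

text \<open>If \<open>u\<close> were outside the finite orbit of \<open>v\<close>, a polynomial equal to 0 at \<open>u\<close> and to 1 on that orbit
  would exist; the product of its translates by \<open>G\<close> is an invariant with different values at \<open>u\<close>
  and \<open>v\<close>, yet every invariant is a polynomial in \<open>\<omega>\<close>.\<close>

lemma orbit_map_separates_orbits:
  assumes "orbit_map G \<omega>" "\<omega> u = \<omega> v"
  obtains g where "g \<in> G" "u = g v"
proof (rule ccontr)
  let ?S = "(\<lambda>g. g v) ` G"
  assume "\<not> thesis"
  then have "u \<notin> ?S"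
    using that by blast
  then obtain q where q: "polynomial_fun q" "\<And>w. w \<in> ?S \<Longrightarrow> q w = 0" "q u \<noteq> 0"
    using polynomial_fun_vanishing_on_finite[of ?S u] finite_G by blast
  \<comment> \<open>\<open>Q\<close> takes the value 0 at \<open>u\<close> and the value 1 on the orbit of \<open>v\<close>.\<close>
  define Q where "Q x = 1 - inverse (q u) * q x" for x
  define P where "P x = (\<Prod>k\<in>G. Q (k x))" for x
  have "polynomial_fun Q"
    unfolding Q_def by (intro polynomial_fun_diff polynomial_fun.intros q)
  then have "P \<in> invariant_polynomials G"
    unfolding P_def by (rule prod_invariant_polynomial)
  then have "P u = P v"
    using assms unfolding orbit_map_def by metis
  moreover have "P u = 0"
    unfolding P_def using finite_G id_mem q(3) by (intro prod_zero bexI[of _ id]) (auto simp: Q_def)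
  moreover have "P v = 1"
    unfolding P_def using q(2) by (intro prod.neutral) (auto simp: Q_def)
  ultimately show False
    by simp
qed

text \<open>Any linear form on the tangent space at \<open>v\<close> is the differential at \<open>v\<close> of some invariant: average
  over \<open>G\<close> a polynomial with that differential at \<open>v\<close> which vanishes to second order at all the other
  points of the orbit.  Triviality of the stabilizer ensures that only the identity contributes to
  the differential of the average.  Since invariants are polynomials in \<open>\<omega>\<close>, their differentials
  kill the kernel of \<open>\<omega>'\<close>.\<close>

lemma orbit_map_derivative_injective_at_free_point:
  assumes \<omega>: "orbit_map G \<omega>" and der: "(\<omega> has_derivative \<omega>') (at v)"
    and free: "\<And>g. g \<in> G \<Longrightarrow> g v = v \<Longrightarrow> g = id" and u: "\<omega>' u = 0"
  shows "u = 0"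
proof (rule ccontr)
  assume "u \<noteq> 0"
  then obtain j where j: "u $ j \<noteq> 0"
    by (metis vec_eq_iff zero_index)
  let ?S = "(\<lambda>g. g v) ` G - {v}"
  obtain q where q: "polynomial_fun q" "\<And>w. w \<in> ?S \<Longrightarrow> q w = 0" "q v \<noteq> 0"
    using polynomial_fun_vanishing_on_finite[of ?S v] finite_G by auto
  \<comment> \<open>At \<open>v\<close> the 1-jet of \<open>Q\<close> is a nonzero multiple of that of the \<open>j\<close>-th coordinate; on the rest of
    the orbit, \<open>Q\<close> vanishes to second order.\<close>
  define Q where "Q x = (x $ j - v $ j) * (q x * q x)" for x
  have Q: "polynomial_fun Q"
    unfolding Q_def by (intro polynomial_fun_diff polynomial_fun.intros q)
  have Q_der: "(Q has_derivative (\<lambda>y. if w = v then y $ j * (q v * q v) else 0)) (at w)"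
    if "w \<in> (\<lambda>g. g v) ` G" for w
  proof -
    obtain q' where q': "(q has_derivative q') (at w)"
      using polynomial_fun_differentiable[OF q(1)] .
    have "((\<lambda>x. x $ j - v $ j) has_derivative (\<lambda>y. y $ j)) (at w)"
      by (auto intro!: derivative_eq_intros bounded_linear.has_derivative[OF bounded_linear_vec_nth])
    from has_derivative_mult[OF this has_derivative_mult[OF q' q']]
    show ?thesis
      unfolding Q_def[abs_def] using that q(2)[of w]
      by (elim has_derivative_eq_rhs) (auto simp: fun_eq_iff)
  qed
  define P where "P x = (\<Sum>k\<in>G. Q (k x))" for x
  have "P \<in> invariant_polynomials G"
    unfolding P_def using Q by (rule sum_invariant_polynomial)
  then obtain R where R: "polynomial_fun R" "\<And>x. P x = R (\<omega> x)"
    using \<omega> unfolding orbit_map_def by metis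
  obtain R' where R': "(R has_derivative R') (at (\<omega> v))"
    using polynomial_fun_differentiable[OF R(1)] .
  have "P = (\<lambda>x. R (\<omega> x))"
    using R(2) by blast
  then have "(P has_derivative (\<lambda>y. R' (\<omega>' y))) (at v)"
    using has_derivative_compose[OF der R'] by simp
  moreover have "(P has_derivative
      (\<lambda>y. \<Sum>k\<in>G. if k v = v then k y $ j * (q v * q v) else 0)) (at v)"
    unfolding P_def
  proof (intro has_derivative_sum)
    fix k assume k: "k \<in> G"
    have "(k has_derivative k) (at v)"
      using clinear[OF k] clinear_map_imp_linear linear_imp_has_derivative by blast
    then show "((\<lambda>x. Q (k x)) has_derivative
        (\<lambda>y. if k v = v then k y $ j * (q v * q v) else 0)) (at v)"
      using has_derivative_compose[OF _ Q_der] k by blast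
  qed
  ultimately have "(\<lambda>y. R' (\<omega>' y)) =
      (\<lambda>y. \<Sum>k\<in>G. if k v = v then k y $ j * (q v * q v) else 0)"
    by (rule has_derivative_unique)
  then have "R' (\<omega>' u) = (\<Sum>k\<in>G. if k v = v then k u $ j * (q v * q v) else 0)"
    by (rule fun_cong)
  also have "\<dots> = (\<Sum>k\<in>G. if k = id then u $ j * (q v * q v) else 0)"
    using free by (intro sum.cong) auto
  also have "\<dots> = u $ j * (q v * q v)"
    using finite_G id_mem by (simp add: sum.delta)
  finally have "R' (\<omega>' u) \<noteq> 0"
    using j q(3) by simp
  moreover have "R' 0 = 0"
    using R' has_derivative_bounded_linear linear_simps(3) by blast
  ultimately show False
    using u by simp
qed

end

section \<open>Zeros of polynomials and linear subspaces\<close>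

text \<open>This rests on the infinity of the ground field: if a vector \<open>a\<close> lies in one subspace but
  avoids the others, all but finitely many points of a line in direction \<open>a\<close> that misses the one
  subspace avoid the others as well.\<close>

lemma exists_vector_avoiding_proper_subspaces:
  fixes \<W> :: "(complex^'p) set set"
  assumes "finite \<W>" "\<And>W. W \<in> \<W> \<Longrightarrow> vec.subspace W" "\<And>W. W \<in> \<W> \<Longrightarrow> W \<noteq> UNIV"
  shows "\<exists>a. \<forall>W\<in>\<W>. a \<notin> W"
  using assms
proof (induction \<W> rule: finite_induct)
  case empty
  then show ?case
    by simp
next
  case (insert W \<W>)
  then obtain a where a: "\<And>W'. W' \<in> \<W> \<Longrightarrow> a \<notin> W'"
    by auto
  obtain b where b: "b \<notin> W"
    using insert.prems by blast
  show ?case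
  proof (cases "a \<in> W")
    case True
    \<comment> \<open>The affine line \<open>b + \<complex> a\<close> misses \<open>W\<close> and meets every other member at most once.\<close>
    have "\<exists>c. \<forall>c'. b + c' *s a \<in> W' \<longrightarrow> c' = c" if W': "W' \<in> \<W>" for W'
    proof (cases "\<exists>c. b + c *s a \<in> W'")
      case True
      then obtain c where c: "b + c *s a \<in> W'"
        by blast
      have "c' = c" if "b + c' *s a \<in> W'" for c'
      proof (rule ccontr)
        assume "c' \<noteq> c"
        have sub: "vec.subspace W'"
          using insert.prems W' by blast
        have "(c' - c) *s a \<in> W'"
          using vec.subspace_diff[OF sub that c] by (simp add: vec.scale_left_diff_distrib)
        then have "inverse (c' - c) *s ((c' - c) *s a) \<in> W'"
          by (rule vec.subspace_scale[OF sub])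
        moreover have "inverse (c' - c) *s ((c' - c) *s a) = a"
          using \<open>c' \<noteq> c\<close> by (simp only: vector_smult_assoc) simp
        ultimately show False
          using a[OF W'] by simp
      qed
      then show ?thesis
        by blast
    qed blast
    then obtain bad where bad: "\<And>W' c'. W' \<in> \<W> \<Longrightarrow> b + c' *s a \<in> W' \<Longrightarrow> c' = bad W'"
      by metis
    obtain c where c: "c \<notin> bad ` \<W>"
      using ex_new_if_finite[OF infinite_UNIV_char_0] insert.hyps by blast
    have "vec.subspace W"
      using insert.prems by blast
    then have "b + c *s a \<notin> W"
      using True b vec.subspace_diff vec.subspace_scale by (metis add_diff_cancel_right')
    then show ?thesis
      using bad c by blast
  qed (use a in blast)
qed

text \<open>Pick \<open>a\<close> outside all the subspaces \<open>W\<close>; by the bound on the dimension the spaces \<open>W + \<complex> a\<close> are still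
  proper, so \<open>b\<close> can be picked outside all of them.\<close>

lemma plane_avoiding_codim_two_subspaces:
  fixes \<W> :: "(complex^'p) set set"
  assumes fin: "finite \<W>" and sub: "\<And>W. W \<in> \<W> \<Longrightarrow> vec.subspace W"
    and dim: "\<And>W. W \<in> \<W> \<Longrightarrow> vec.dim W + 2 \<le> CARD('p)"
  shows "\<exists>a b. \<forall>W\<in>\<W>. \<forall>s t. s *s a + t *s b \<in> W \<longrightarrow> s = 0 \<and> t = 0"
proof -
  have "W \<noteq> UNIV" if "W \<in> \<W>" for W
    using dim[OF that] vec_dim_card[where 'a = complex and 'n = 'p] by auto
  then obtain a where a: "\<And>W. W \<in> \<W> \<Longrightarrow> a \<notin> W"
    using exists_vector_avoiding_proper_subspaces[OF fin sub] by blast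
  have "vec.span (insert a W) \<noteq> UNIV" if "W \<in> \<W>" for W
  proof -
    have "vec.dim (insert a W) < CARD('p)"
      using dim[OF that] by (simp add: vec.dim_insert)
    then show ?thesis
      by (metis less_irrefl vec.dim_span vec_dim_card)
  qed
  then obtain b where b: "\<And>W. W \<in> \<W> \<Longrightarrow> b \<notin> vec.span (insert a W)"
    using exists_vector_avoiding_proper_subspaces[of "(\<lambda>W. vec.span (insert a W)) ` \<W>"] fin
    by (auto simp: vec.subspace_span)
  show ?thesis
  proof (rule exI[of _ a], rule exI[of _ b], intro ballI allI impI)
    fix W s t
    assume W: "W \<in> \<W>" and st: "s *s a + t *s b \<in> W"
    have "t = 0"
    proof (rule ccontr)
      assume "t \<noteq> 0"
      have "s *s a + t *s b \<in> vec.span (insert a W)" "s *s a \<in> vec.span (insert a W)"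
        using st by (auto intro: vec.span_base vec.span_scale)
      then have "t *s b \<in> vec.span (insert a W)"
        using vec.span_diff by fastforce
      then have "inverse t *s (t *s b) \<in> vec.span (insert a W)"
        by (rule vec.span_scale)
      then show False
        using b[OF W] \<open>t \<noteq> 0\<close> by simp
    qed
    moreover have "s = 0"
    proof (rule ccontr)
      assume "s \<noteq> 0"
      have "inverse s *s (s *s a) \<in> W"
        by (rule vec.subspace_scale[OF sub[OF W]]) (use st \<open>t = 0\<close> in simp)
      then show False
        using a[OF W] \<open>s \<noteq> 0\<close> by simp
    qed
    ultimately show "s = 0 \<and> t = 0"
      by blast
  qed
qed

text \<open>A hypersurface has no component of codimension 2: restricted to the plane \<open>v + s a + t b\<close>, a
  polynomial cannot vanish at \<open>v\<close> alone.  Otherwise the functions \<open>s \<mapsto> P (v + s a + t b)\<close> with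
  \<open>t \<noteq> 0\<close> would have no zeros near 0, and as \<open>t \<rightarrow> 0\<close> they converge uniformly to a non-constant function
  that vanishes at \<open>s = 0\<close>, against Hurwitz's theorem.\<close>

lemma polynomial_fun_no_isolated_zero_on_plane:
  fixes P :: "complex^'p \<Rightarrow> complex"
  assumes P: "polynomial_fun P" and r: "r > 0"
    and nz: "\<And>s t. cmod s < r \<Longrightarrow> cmod t < r \<Longrightarrow> (s, t) \<noteq> (0, 0) \<Longrightarrow> P (v + s *s a + t *s b) \<noteq> 0"
  shows "P v \<noteq> 0"
proof
  assume zero: "P v = 0"
  \<comment> \<open>The shift by 2 keeps the parameter \<open>t = r / (2 + n)\<close> below \<open>r\<close> for every \<open>n\<close>.\<close>
  define F where "F n s = P (v + s *s a + complex_of_real (r / (2 + real n)) *s b)" for n :: nat and s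
  define F0 where "F0 s = P (v + s *s a)" for s
  have "F0 0 \<noteq> 0"
  proof (rule Hurwitz_no_zeros[of "ball 0 r" F F0])
    show "F n holomorphic_on ball 0 r" for n
    proof -
      have "F n = (\<lambda>s. P ((v + complex_of_real (r / (2 + real n)) *s b) + s *s a))"
        by (simp add: F_def fun_eq_iff add_ac)
      then show ?thesis
        using holomorphic_on_polynomial_fun_line[OF P] by simp
    qed
    show "F0 holomorphic_on ball 0 r"
      unfolding F0_def[abs_def] by (rule holomorphic_on_polynomial_fun_line[OF P])
    show "uniform_limit K F F0 sequentially" if K: "compact K" for K
    proof (rule uniform_limitI)
      fix e :: real
      assume "e > 0"
      have lin: "bounded_linear (\<lambda>z :: complex \<times> complex. fst z *s c)"
        "bounded_linear (\<lambda>z :: complex \<times> complex. snd z *s c)"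
        for c :: "complex^'p"
        by (auto intro!: linear_conv_bounded_linear[THEN iffD1] linearI
            simp: vec_eq_iff scaleR_conv_of_real[where 'a = complex] algebra_simps)
      have "continuous_on UNIV (\<lambda>z :: complex \<times> complex. v + snd z *s a + fst z *s b)"
        by (intro continuous_on_add continuous_on_const lin[THEN linear_continuous_on])
      then have "continuous_on UNIV (\<lambda>z. P (v + snd z *s a + fst z *s b))"
        by (rule continuous_on_compose2[OF continuous_on_polynomial_fun[OF P, of UNIV]]) simp
      then have "continuous_on (UNIV \<times> K) (\<lambda>(t, s). P (v + s *s a + t *s b))"
        unfolding case_prod_beta by (rule continuous_on_subset) simp
      from continuous_on_prod_compactE[OF this K UNIV_I half_gt_zero[OF \<open>e > 0\<close>], of 0]
      obtain T where T: "0 \<in> T" "open T"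
        and "\<forall>t\<in>T \<inter> UNIV. \<forall>s\<in>K. dist (case (t, s) of (t, s) \<Rightarrow> P (v + s *s a + t *s b))
          (case (0, s) of (t, s) \<Rightarrow> P (v + s *s a + t *s b)) \<le> e / 2" .
      then have close: "dist (P (v + s *s a + t *s b)) (P (v + s *s a)) \<le> e / 2"
        if "t \<in> T" "s \<in> K" for t s
        using that by force
      have "(\<lambda>n. complex_of_real (r / (2 + real n))) \<longlonglongrightarrow> of_real 0"
        by (intro tendsto_of_real real_tendsto_divide_at_top[OF tendsto_const]
            filterlim_tendsto_add_at_top[OF tendsto_const filterlim_real_sequentially])
      then have "\<forall>\<^sub>F n in sequentially. complex_of_real (r / (2 + real n)) \<in> T"
        using T topological_tendstoD by fastforce
      then show "\<forall>\<^sub>F n in sequentially. \<forall>s\<in>K. dist (F n s) (F0 s) < e"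
      proof eventually_elim
        case (elim n)
        show ?case
        proof
          fix s
          assume "s \<in> K"
          from close[OF elim this] \<open>e > 0\<close> show "dist (F n s) (F0 s) < e"
            by (simp add: F_def F0_def)
        qed
      qed
    qed
    show "\<not> F0 constant_on ball 0 r"
    proof
      assume "F0 constant_on ball 0 r"
      then have "F0 (of_real (r / 2)) = F0 0"
        using r unfolding constant_on_def by (auto simp: norm_divide)
      moreover have "F0 (of_real (r / 2)) \<noteq> 0"
        using nz[of "of_real (r / 2)" 0] r by (simp add: F0_def norm_divide)
      ultimately show False
        using zero by (simp add: F0_def)
    qed
    show "F n s \<noteq> 0" if "s \<in> ball 0 r" for n s
    proof -
      have "r / (2 + real n) < r"
        using r by (simp add: divide_less_eq)
      then have "cmod (of_real (r / (2 + real n))) < r"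
        using r by (simp only: norm_of_real) simp
      moreover have "complex_of_real (r / (2 + real n)) \<noteq> 0"
        using r by (simp only: of_real_eq_0_iff divide_eq_0_iff) linarith
      ultimately show ?thesis
        unfolding F_def using nz[of s "of_real (r / (2 + real n))"] that by simp
    qed
  qed (use r in auto)
  then show False
    using zero by (simp add: F0_def)
qed

section \<open>The critical points of the orbit map of a reflection group\<close>

lemma unitary_map_inj:
  assumes H: "pos_def_hermitian H" and g: "unitary_map H g"
  shows "inj g"
proof -
  interpret Vector_Spaces.linear "(*s)" "(*s)" g
    using g by (simp add: unitary_map_def)
  have "u = 0" if "g u = 0" for u
  proof (rule ccontr)
    assume "u \<noteq> 0"
    have "H 0 w = 0" for w
    proof -
      have "H (0 *s w) w = 0 * H w w"
        using H unfolding pos_def_hermitian_def by blast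
      then show ?thesis
        by simp
    qed
    then have "H (g u) (g u) = 0"
      using that by simp
    then have "H u u = 0"
      using g by (simp add: unitary_map_def)
    moreover have "0 < Re (H u u)"
      using H \<open>u \<noteq> 0\<close> unfolding pos_def_hermitian_def by blast
    ultimately show False
      by simp
  qed
  then show ?thesis
    using inj_iff_eq_0 by blast
qed

lemma reflection_group_unitary:
  assumes "reflection_group H G" "g \<in> G"
  shows "unitary_map H g"
  using assms subgroup.mem_carrier
  by (fastforce simp: reflection_group_def unitary_group_def)

lemma reflection_group_finite_linear_group:
  assumes H: "pos_def_hermitian H" and G: "reflection_group H G"
  shows "finite_linear_group G"
proof (rule finite_linear_group.intro)
  have sub: "subgroup G (unitary_group H)"
    using G by (simp add: reflection_group_def)
  show "finite G"
    using G by (simp add: reflection_group_def)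
  show "id \<in> G"
    using subgroup.one_closed[OF sub] by (simp add: unitary_group_def)
  show "g \<circ> k \<in> G" if "g \<in> G" "k \<in> G" for g k
    using subgroup.m_closed[OF sub that] by (simp add: unitary_group_def)
  show "clinear_map g" "inj g" if "g \<in> G" for g
    using reflection_group_unitary[OF G that] unitary_map_inj[OF H]
    by (auto simp: unitary_map_def)
qed

lemma (in finite_linear_group) finite_order:
  assumes "g \<in> G"
  obtains n where "n \<ge> 1" "g ^^ n = id"
proof -
  have mem: "g ^^ n \<in> G" for n
    by (induction n) (simp_all only: funpow.simps id_mem comp_mem[OF assms])
  have "\<not> inj (\<lambda>n. g ^^ n)"
    using finite_G mem by (metis finite_imageD finite_subset image_subsetI infinite_UNIV_nat)
  then obtain m n where mn: "m < n" "g ^^ m = g ^^ n"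
    unfolding inj_def by (metis linorder_neqE_nat)
  have "inj (g ^^ m)"
    using mem inj by blast
  moreover have "(g ^^ m) ((g ^^ (n - m)) x) = (g ^^ m) x" for x
    using mn by (metis comp_apply funpow_add le_add_diff_inverse less_imp_le)
  ultimately have "g ^^ (n - m) = id"
    by (metis eq_id_iff injD)
  then show thesis
    using that[of "n - m"] mn by simp
qed

lemma subspace_fixed_space:
  assumes "clinear_map g"
  shows "vec.subspace (fixed_space g)"
proof -
  interpret Vector_Spaces.linear "(*s)" "(*s)" g by fact
  show ?thesis
    by (auto simp: vec.subspace_def fixed_space_def zero add scale)
qed

lemma closed_fixed_space:
  assumes "clinear_map g"
  shows "closed (fixed_space g)"
proof -
  have "continuous_on UNIV g"
    using clinear_map_imp_linear[OF assms] linear_continuous_on linear_conv_bounded_linear by blast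
  then show ?thesis
    unfolding fixed_space_def by (intro closed_Collect_eq) auto
qed

text \<open>Inside a finite unitary group, having a fixed space of codimension 1 is all that it takes to be a
  reflection, because finite order is automatic.\<close>

lemma fixed_space_codim_two:
  fixes G :: "(complex^'p \<Rightarrow> complex^'p) set"
  assumes H: "pos_def_hermitian H" and G: "reflection_group H G"
    and g: "g \<in> G" "\<not> is_reflection H g" "g \<noteq> id"
  shows "vec.dim (fixed_space g) + 2 \<le> CARD('p)"
proof -
  interpret finite_linear_group G
    using reflection_group_finite_linear_group[OF H G] .
  have "vec.dim (fixed_space g) + 1 \<noteq> CARD('p)"
    using g reflection_group_unitary[OF G] finite_order[OF g(1)] unfolding is_reflection_def by metis
  moreover have "vec.dim (fixed_space g) \<noteq> CARD('p)"
  proof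
    assume "vec.dim (fixed_space g) = CARD('p)"
    then have "vec.dim (fixed_space g) = vec.dim (UNIV :: (complex^'p) set)"
      by (simp only: vec_dim_card)
    then have "vec.span (fixed_space g) = UNIV"
      using vec.dim_eq_full[of "fixed_space g", unfolded vec.dimension_def] by simp
    then have "fixed_space g = UNIV"
      using subspace_fixed_space[OF clinear[OF g(1)]] by (metis vec.span_eq_iff)
    then show False
      using g(3) by (auto simp: fixed_space_def fun_eq_iff)
  qed
  moreover have "vec.dim (fixed_space g) \<le> CARD('p)"
    using vec.dim_subset[OF subset_UNIV, of "fixed_space g"] by (simp only: vec_dim_card)
  ultimately show ?thesis
    by linarith
qed

text \<open>Conjugation by \<open>g\<close> carries a reflection to a reflection and moves its hyperplane by \<open>g\<close>.\<close>

lemma arrangement_invariant: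
  assumes H: "pos_def_hermitian H" and G: "reflection_group H G"
    and g: "g \<in> G" and v: "v \<in> arrangement H G"
  shows "g v \<in> arrangement H G"
proof -
  interpret finite_linear_group G
    using reflection_group_finite_linear_group[OF H G] .
  obtain r where r: "r \<in> G" "is_reflection H r" "r v = v"
    using v by (auto simp: arrangement_def fixed_space_def)
  obtain k where k: "k \<in> G" "g \<circ> k = id" "k \<circ> g = id"
    using inverse_exists[OF g] .
  have kg: "g (k x) = x" "k (g x) = x" for x
    using k by (simp_all add: pointfree_idE)
  define r' where "r' = g \<circ> r \<circ> k"
  have r': "r' \<in> G"
    using g k r comp_mem by (simp add: r'_def)
  have "fixed_space r' = g ` fixed_space r"
  proof (intro equalityI subsetI)
    fix x
    assume "x \<in> fixed_space r'"
    then have "g (r (k x)) = x"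
      by (simp add: r'_def fixed_space_def)
    then have "r (k x) = k x"
      using kg by metis
    then show "x \<in> g ` fixed_space r"
      using kg(1)[of x] by (metis (mono_tags) fixed_space_def imageI mem_Collect_eq)
  qed (auto simp: r'_def fixed_space_def kg)
  then have "vec.dim (fixed_space r') = vec.dim (fixed_space r)"
    using vec.dim_image_eq[OF clinear[OF g]] inj[OF g] by (metis inj_on_subset subset_UNIV)
  then have "is_reflection H r'"
    using r(2) reflection_group_unitary[OF G r'] finite_order[OF r']
    unfolding is_reflection_def by metis
  moreover have "r' (g v) = g v"
    using r kg by (simp add: r'_def)
  ultimately show ?thesis
    using r' by (auto simp: arrangement_def fixed_space_def)
qed

text \<open>If \<open>r\<close> is a reflection fixing \<open>v\<close>, differentiating \<open>\<omega> \<circ> r = \<omega>\<close> at \<open>v\<close> gives \<open>\<omega>' \<circ> r = \<omega>'\<close>, so \<open>\<omega>'\<close>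
  identifies \<open>u\<close> with \<open>r u\<close>, while \<open>r\<close> is not the identity.\<close>

lemma orbit_map_derivative_not_injective_on_arrangement:
  fixes \<omega> :: "complex^'p \<Rightarrow> complex^'p"
  assumes H: "pos_def_hermitian H" and G: "reflection_group H G" and \<omega>: "orbit_map G \<omega>"
    and v: "v \<in> arrangement H G" and der: "(\<omega> has_derivative \<omega>') (at v)"
  shows "\<not> inj \<omega>'"
proof
  interpret finite_linear_group G
    using reflection_group_finite_linear_group[OF H G] .
  assume inj_\<omega>': "inj \<omega>'"
  obtain r where r: "r \<in> G" "is_reflection H r" "r v = v"
    using v by (auto simp: arrangement_def fixed_space_def)
  have "(r has_derivative r) (at v)"
    using clinear[OF r(1)] clinear_map_imp_linear linear_imp_has_derivative by blast
  then have "((\<lambda>x. \<omega> (r x)) has_derivative (\<lambda>u. \<omega>' (r u))) (at v)"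
    by (rule has_derivative_compose) (use der r(3) in simp)
  moreover have "(\<lambda>x. \<omega> (r x)) = \<omega>"
    using orbit_map_invariant[OF \<omega> r(1)] by blast
  ultimately have "(\<lambda>u. \<omega>' (r u)) = \<omega>'"
    using der has_derivative_unique by metis
  then have "r u = u" for u
    using inj_\<omega>' by (metis injD)
  then have "fixed_space r = UNIV"
    by (simp add: fixed_space_def)
  then have "vec.dim (fixed_space r) = CARD('p)"
    by (simp only: vec_dim_card)
  then show False
    using r(2) by (simp add: is_reflection_def)
qed

text \<open>Near a point \<open>v\<close> off the hyperplanes, the only points with non-trivial stabilizer lie in the fixed
  spaces of those non-identity elements of \<open>G\<close> that fix \<open>v\<close>; none of them is a reflection, so these
  spaces have codimension at least 2.  The zeros of the Jacobian determinant near \<open>v\<close> lie in the union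
  of these spaces, and for suitable vectors \<open>a\<close> and \<open>b\<close> a point \<open>v + s a + t b\<close> with \<open>(s, t) \<noteq> (0, 0)\<close>
  never does.  But the determinant is a polynomial in \<open>s\<close> and \<open>t\<close>, so \<open>(0, 0)\<close> cannot be its only zero
  nearby.\<close>

lemma orbit_map_derivative_injective_off_arrangement:
  fixes \<omega> :: "complex^'p \<Rightarrow> complex^'p"
  assumes H: "pos_def_hermitian H" and G: "reflection_group H G" and \<omega>: "orbit_map G \<omega>"
    and v: "v \<notin> arrangement H G" and der: "(\<omega> has_derivative \<omega>') (at v)"
  shows "inj \<omega>'"
proof -
  interpret finite_linear_group G
    using reflection_group_finite_linear_group[OF H G] .
  obtain W where W: "\<And>i j. polynomial_fun (\<lambda>v. W v $ i $ j)"
    and W_der: "\<And>v. (\<omega> has_derivative (\<lambda>u. W v *v u)) (at v)"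
    using polynomial_map_has_derivative[of \<omega>] \<omega>
    unfolding orbit_map_def invariant_polynomials_def by blast
  have det_iff: "det (W x) \<noteq> 0 \<longleftrightarrow> (\<forall>u. W x *v u = 0 \<longrightarrow> u = 0)" for x
    using invertible_det_nz invertible_left_inverse matrix_left_invertible_ker by metis
  have free: "det (W x) \<noteq> 0" if "\<And>g. g \<in> G \<Longrightarrow> g x = x \<Longrightarrow> g = id" for x
    using orbit_map_derivative_injective_at_free_point[OF \<omega> W_der that] det_iff by blast
  \<comment> \<open>The fixed spaces through \<open>v\<close> make up \<open>\<W>\<close>; those missing \<open>v\<close> make up the closed set \<open>C\<close>, which a
    small ball around \<open>v\<close> avoids.\<close>
  define \<W> where "\<W> = fixed_space ` {g \<in> G. g v = v \<and> g \<noteq> id}"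
  define C where "C = (\<Union>g\<in>{g \<in> G. g v \<noteq> v}. fixed_space g)"
  have "closed C"
    unfolding C_def using finite_G by (intro closed_UN) (auto intro: closed_fixed_space clinear)
  moreover have "v \<notin> C"
    by (auto simp: C_def fixed_space_def)
  ultimately obtain \<epsilon> where \<epsilon>: "\<epsilon> > 0" "ball v \<epsilon> \<inter> C = {}"
    by (metis ComplI disjoint_eq_subset_Compl open_Compl open_contains_ball)
  have subW: "vec.subspace U" if "U \<in> \<W>" for U
    using that by (auto simp: \<W>_def intro: subspace_fixed_space clinear)
  have "vec.dim U + 2 \<le> CARD('p)" if U: "U \<in> \<W>" for U
  proof -
    obtain g where g: "g \<in> G" "g v = v" "g \<noteq> id" "U = fixed_space g"
      using U unfolding \<W>_def by blast
    then have "\<not> is_reflection H g"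
      using v by (auto simp: arrangement_def fixed_space_def)
    then show ?thesis
      using fixed_space_codim_two[OF H G] g by blast
  qed
  moreover have "finite \<W>"
    using finite_G by (simp add: \<W>_def)
  ultimately obtain a b
    where ab: "\<And>U s t. U \<in> \<W> \<Longrightarrow> s *s a + t *s b \<in> U \<Longrightarrow> s = 0 \<and> t = 0"
    using plane_avoiding_codim_two_subspaces[of \<W>] subW by blast
  have scale: "norm (c *s x) = cmod c * norm x" for c and x :: "complex^'p"
    by (simp add: norm_vec_def norm_mult L2_set_right_distrib)
  \<comment> \<open>This radius keeps all points \<open>v + s a + t b\<close> with \<open>|s|, |t| < r\<close> inside the ball.\<close>
  define r where "r = \<epsilon> / (norm a + norm b + 1)"
  have r: "r > 0"
    using \<epsilon> by (simp add: r_def add_nonneg_pos)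
  have "det (W (v + s *s a + t *s b)) \<noteq> 0"
    if st: "cmod s < r" "cmod t < r" "(s, t) \<noteq> (0, 0)" for s t
  proof (rule free)
    let ?x = "v + s *s a + t *s b"
    fix g
    assume g: "g \<in> G" "g ?x = ?x"
    have "norm (s *s a + t *s b) \<le> cmod s * norm a + cmod t * norm b"
      by (metis norm_triangle_ineq scale)
    also have "\<dots> \<le> r * norm a + r * norm b"
      using st by (intro add_mono mult_right_mono) auto
    also have "\<dots> < r * (norm a + norm b + 1)"
      using r by (simp add: algebra_simps)
    also have "\<dots> = \<epsilon>"
      by (simp add: r_def add_nonneg_pos[THEN less_imp_neq, symmetric])
    finally have "?x \<in> ball v \<epsilon>"
      by (simp add: dist_norm norm_minus_commute add_ac)
    then have "?x \<notin> C"
      using \<epsilon> by blast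
    then have "g v = v"
      using g by (auto simp: C_def fixed_space_def)
    interpret g: Vector_Spaces.linear "(*s)" "(*s)" g
      using clinear[OF g(1)] .
    have "g (s *s a + t *s b) = s *s a + t *s b"
      using g(2) \<open>g v = v\<close> by (simp add: g.add add.assoc)
    then show "g = id"
      using ab[of "fixed_space g" s t] g(1) \<open>g v = v\<close> st(3)
      by (auto simp: \<W>_def fixed_space_def)
  qed
  then have "det (W v) \<noteq> 0"
    using polynomial_fun_no_isolated_zero_on_plane[OF polynomial_fun_det[OF W] r] by blast
  then have "inj (\<lambda>u. W v *v u)"
    using det_iff vec.inj_iff_eq_0 by blast
  then show ?thesis
    using has_derivative_unique[OF der W_der] by simp
qed

section \<open>Transversality at a point\<close>

definition transverse_at ::
    "(complex^'m) set \<Rightarrow> nat \<Rightarrow> (nat \<Rightarrow> ('a, 'm) chart) \<Rightarrow> ((nat \<Rightarrow> 'a) \<Rightarrow> (nat \<Rightarrow> complex^'q)) \<Rightarrow>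
     (nat \<Rightarrow> 'a) \<Rightarrow> bool" where
  "transverse_at E k c \<Phi> x \<longleftrightarrow>
     {\<lambda>i\<in>{..<k}. a i + b i | a b.
        a \<in> differential k c \<Phi> x ` ({..<k} \<rightarrow>\<^sub>E E) \<and> b \<in> small_diagonal UNIV k}
     = ({..<k} \<rightarrow>\<^sub>E UNIV)"

lemma transverse_to_diagonal_iff:
  "transverse_to_diagonal E A k M \<Phi> \<longleftrightarrow>
     (\<forall>x\<in>M. \<Phi> x \<in> small_diagonal UNIV k \<longrightarrow>
        (\<forall>c. (\<forall>i<k. c i \<in> A \<and> x i \<in> fst (c i)) \<longrightarrow> transverse_at E k c \<Phi> x))"
  by (simp only: transverse_to_diagonal_def transverse_at_def)

lemma product_map_in_diagonal_iff:
  "product_map k F x \<in> small_diagonal UNIV k \<longleftrightarrow> (\<forall>i<k. \<forall>j<k. F i (x i) = F j (x j))"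
proof -
  have "product_map k F x \<in> {..<k} \<rightarrow>\<^sub>E UNIV"
    by (simp add: product_map_def)
  moreover have "product_map k F x i = product_map k F x j \<longleftrightarrow> F i (x i) = F j (x j)"
    if "i < k" "j < k" for i j
    using that by (simp add: product_map_def)
  ultimately show ?thesis
    unfolding small_diagonal_def by blast
qed

definition spans_with_diagonal :: "'e set \<Rightarrow> nat \<Rightarrow> (nat \<Rightarrow> 'e \<Rightarrow> 'v::ab_group_add) \<Rightarrow> bool" where
  "spans_with_diagonal E k N \<longleftrightarrow>
     (\<forall>y. \<exists>u b. \<forall>i<k. u i \<in> E \<and> y i = N i (u i) + b)"

text \<open>Once the derivatives of the factors along the coordinate lines are known to be \<open>N i\<close>, transversality
  is a statement of linear algebra about the \<open>N i\<close>, free of extensional functions.\<close>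

lemma transverse_at_iff_spans_with_diagonal:
  fixes N :: "nat \<Rightarrow> complex^'m \<Rightarrow> complex^'q"
  assumes "k > 0"
    and der: "\<And>i w. i < k \<Longrightarrow> w \<in> E \<Longrightarrow>
      ((\<lambda>t. F i (inv_into (fst (c i)) (snd (c i)) (snd (c i) (x i) + t *\<^sub>R w)))
        has_vector_derivative N i w) (at 0)"
  shows "transverse_at E k c (product_map k F) x \<longleftrightarrow> spans_with_diagonal E k N"
proof -
  have diff: "differential k c (product_map k F) x u = (\<lambda>i\<in>{..<k}. N i (u i))"
    if "u \<in> {..<k} \<rightarrow>\<^sub>E E" for u
    unfolding differential_def using that der
    by (intro restrict_ext) (auto simp: product_map_def chart_curve_def intro!: vector_derivative_at)
  show ?thesis
  proof
    assume *: "transverse_at E k c (product_map k F) x"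
    show "spans_with_diagonal E k N"
      unfolding spans_with_diagonal_def
    proof
      fix y :: "nat \<Rightarrow> complex^'q"
      have "restrict y {..<k} \<in> {..<k} \<rightarrow>\<^sub>E UNIV"
        by simp
      then obtain u b where u: "u \<in> {..<k} \<rightarrow>\<^sub>E E" and b: "b \<in> small_diagonal UNIV k"
        and y: "restrict y {..<k} = (\<lambda>i\<in>{..<k}. differential k c (product_map k F) x u i + b i)"
        using * unfolding transverse_at_def by blast
      have "y i = N i (u i) + b 0" if "i < k" for i
      proof -
        have "y i = N i (u i) + b i"
          using fun_cong[OF y, of i] diff[OF u] that by simp
        moreover have "b i = b 0"
          using b that \<open>k > 0\<close> unfolding small_diagonal_def by blast
        ultimately show ?thesis
          by simp
      qed
      then show "\<exists>u b. \<forall>i<k. u i \<in> E \<and> y i = N i (u i) + b"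
        using u by (intro exI[of _ u] exI[of _ "b 0"]) auto
    qed
  next
    assume *: "spans_with_diagonal E k N"
    show "transverse_at E k c (product_map k F) x"
      unfolding transverse_at_def
    proof (intro equalityI subsetI)
      fix y :: "nat \<Rightarrow> complex^'q"
      assume y: "y \<in> {..<k} \<rightarrow>\<^sub>E UNIV"
      obtain u b where ub: "\<And>i. i < k \<Longrightarrow> u i \<in> E \<and> y i = N i (u i) + b"
        using * unfolding spans_with_diagonal_def by metis
      let ?u = "restrict u {..<k}" and ?b = "\<lambda>i\<in>{..<k}. b"
      have u: "?u \<in> {..<k} \<rightarrow>\<^sub>E E"
        using ub by auto
      moreover have "?b \<in> small_diagonal UNIV k"
        by (simp add: small_diagonal_def)
      moreover have "y = (\<lambda>i\<in>{..<k}. differential k c (product_map k F) x ?u i + ?b i)"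
        using ub y by (auto simp: diff[OF u] fun_eq_iff PiE_def extensional_def)
      ultimately show "y \<in> {\<lambda>i\<in>{..<k}. a i + b i | a b.
          a \<in> differential k c (product_map k F) x ` ({..<k} \<rightarrow>\<^sub>E E) \<and> b \<in> small_diagonal UNIV k}"
        by blast
    qed auto
  qed
qed

text \<open>With at least two factors, comparing two of them shows that the image of \<open>L\<close> contains every
  vector; a surjective endomorphism of a finite-dimensional space is invertible, and an invertible
  \<open>L\<close> acts on all factors at once, preserving the diagonal.\<close>

lemma spans_with_diagonal_comp_linear:
  fixes L :: "'v::euclidean_space \<Rightarrow> 'v"
  assumes "k \<ge> 2" and L: "linear L"
  shows "spans_with_diagonal E k (\<lambda>i w. L (N i w)) \<longleftrightarrow> inj L \<and> spans_with_diagonal E k N"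
proof
  assume *: "spans_with_diagonal E k (\<lambda>i w. L (N i w))"
  have "z \<in> range L" for z
  proof -
    obtain u b where ub: "\<And>i. i < k \<Longrightarrow> (if i = 0 then z else 0) = L (N i (u i)) + b"
      using *[unfolded spans_with_diagonal_def, THEN spec, of "\<lambda>i. if i = 0 then z else 0"] by blast
    have "z = L (N 0 (u 0)) + b" "0 = L (N 1 (u 1)) + b"
      using ub[of 0] ub[of 1] \<open>k \<ge> 2\<close> by auto
    then have "z = L (N 0 (u 0) - N 1 (u 1))"
      using linear_diff[OF L] by (metis add_diff_cancel_right diff_zero)
    then show ?thesis
      by blast
  qed
  then have surj: "surj L"
    by blast
  then have inj: "inj L"
    using L linear_surj_imp_inj by blast
  have "spans_with_diagonal E k N"
    unfolding spans_with_diagonal_def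
  proof
    fix y :: "nat \<Rightarrow> 'v"
    obtain u b where ub: "\<And>i. i < k \<Longrightarrow> u i \<in> E \<and> L (y i) = L (N i (u i)) + b"
      using *[unfolded spans_with_diagonal_def, THEN spec, of "\<lambda>i. L (y i)"] by blast
    obtain b' where "b = L b'"
      using surj by blast
    then have "y i = N i (u i) + b'" if "i < k" for i
      using ub[OF that] linear_add[OF L] inj by (metis injD)
    then show "\<exists>u b. \<forall>i<k. u i \<in> E \<and> y i = N i (u i) + b"
      using ub by blast
  qed
  with inj show "inj L \<and> spans_with_diagonal E k N" ..
next
  assume *: "inj L \<and> spans_with_diagonal E k N"
  then have "surj L"
    using L linear_injective_imp_surjective by blast
  show "spans_with_diagonal E k (\<lambda>i w. L (N i w))"
    unfolding spans_with_diagonal_def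
  proof
    fix y :: "nat \<Rightarrow> 'v"
    have "\<forall>i. \<exists>z. y i = L z"
      using \<open>surj L\<close> by blast
    then obtain z where z: "\<And>i. y i = L (z i)"
      by metis
    obtain u b where ub: "\<And>i. i < k \<Longrightarrow> u i \<in> E \<and> z i = N i (u i) + b"
      using * unfolding spans_with_diagonal_def by metis
    have "y i = L (N i (u i)) + L b" if "i < k" for i
      using ub[OF that] by (simp add: z linear_add[OF L])
    then show "\<exists>u b. \<forall>i<k. u i \<in> E \<and> y i = L (N i (u i)) + b"
      using ub by blast
  qed
qed

text \<open>Because the image of a chart is relatively open in the model space \<open>E\<close>, a line in a direction from
  \<open>E\<close> stays in it for small parameters, so the derivative within that image suffices.\<close>

lemma holomorphic_has_vector_derivative_along_chart_line:
  fixes F :: "'a \<Rightarrow> complex^'q" and E :: "(complex^'m) set"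
  assumes E: "vec.subspace E" and chart: "complex_chart X E (U, \<phi>)"
    and hol: "holomorphic_within (F \<circ> inv_into U \<phi>) (\<phi> ` U)" and x: "x \<in> U"
  shows "\<exists>D. \<forall>w\<in>E.
    ((\<lambda>t. F (inv_into U \<phi> (\<phi> x + t *\<^sub>R w))) has_vector_derivative D w) (at 0)"
proof -
  obtain D where D: "((F \<circ> inv_into U \<phi>) has_derivative D) (at (\<phi> x) within \<phi> ` U)"
    using hol x unfolding holomorphic_within_def by blast
  obtain T where T: "open T" "\<phi> ` U = E \<inter> T"
    using chart by (auto simp: complex_chart_def openin_open)
  show ?thesis
  proof (rule exI[of _ D], rule ballI)
    fix w
    assume w: "w \<in> E"
    define \<gamma> where "\<gamma> t = \<phi> x + t *\<^sub>R w" for t :: real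
    have cont: "continuous_on UNIV \<gamma>"
      unfolding \<gamma>_def by (intro continuous_intros)
    have N: "open (\<gamma> -` T)" "0 \<in> \<gamma> -` T"
      using open_vimage[OF T(1) cont] x T by (auto simp: \<gamma>_def)
    have "\<gamma> t \<in> E" for t
    proof -
      have "t *\<^sub>R w = complex_of_real t *s w"
        by (simp add: vec_eq_iff scaleR_conv_of_real[where 'a = complex])
      moreover have "\<phi> x \<in> E"
        using x T by blast
      ultimately show ?thesis
        unfolding \<gamma>_def using w vec.subspace_add[OF E] vec.subspace_scale[OF E] by simp
    qed
    then have sub: "\<gamma> ` (\<gamma> -` T) \<subseteq> \<phi> ` U"
      using T by blast
    have "(\<gamma> has_derivative (\<lambda>t. t *\<^sub>R w)) (at 0 within \<gamma> -` T)"
      unfolding \<gamma>_def by (auto intro!: derivative_eq_intros)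
    moreover have "((F \<circ> inv_into U \<phi>) has_derivative D) (at (\<gamma> 0) within \<gamma> ` (\<gamma> -` T))"
      using has_derivative_subset[OF D sub] by (simp add: \<gamma>_def)
    ultimately have "((\<lambda>t. (F \<circ> inv_into U \<phi>) (\<gamma> t)) has_derivative (\<lambda>t. D (t *\<^sub>R w)))
        (at 0 within \<gamma> -` T)"
      by (rule has_derivative_in_compose)
    moreover have "D (t *\<^sub>R w) = t *\<^sub>R D w" for t
      using linear_scale[OF has_derivative_linear[OF D]] .
    ultimately show "((\<lambda>t. F (inv_into U \<phi> (\<phi> x + t *\<^sub>R w))) has_vector_derivative D w) (at 0)"
      using at_within_open[OF N(2,1)] by (simp add: has_vector_derivative_def \<gamma>_def)
  qed
qed

text \<open>At a tuple of points whose images under \<open>h\<close> lie in one orbit, moving these images to a common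
  point \<open>v\<close> by elements \<open>g i\<close> of \<open>G\<close> splits the transversality of \<open>\<omega> \<circ> h\<close> into regularity of \<open>\<omega>\<close> at
  \<open>v\<close> and transversality of the maps \<open>g i \<circ> h\<close>.\<close>

lemma orbit_map_transverse_at_iff:
  fixes E :: "(complex^'m) set" and h :: "'a \<Rightarrow> complex^'p"
  assumes data: "quasi_reflection_data X E A H G \<omega> h"
    and k: "k \<ge> 2" and c: "\<And>i. i < k \<Longrightarrow> c i \<in> A \<and> x i \<in> fst (c i)"
    and g: "\<And>i. i < k \<Longrightarrow> g i \<in> G" "\<And>i. i < k \<Longrightarrow> g i (h (x i)) = v"
    and der: "(\<omega> has_derivative \<omega>') (at v)"
  shows "transverse_at E k c (product_map k (\<lambda>_. \<omega> \<circ> h)) x \<longleftrightarrow>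
           inj \<omega>' \<and> transverse_at E k c (product_map k (\<lambda>i. g i \<circ> h)) x"
proof -
  have H: "pos_def_hermitian H" and G: "reflection_group H G" and \<omega>: "orbit_map G \<omega>"
    and E: "vec.subspace E"
    using data by (auto simp: quasi_reflection_data_def complex_manifold_def)
  interpret finite_linear_group G
    using reflection_group_finite_linear_group[OF H G] .
  define \<gamma> where
    "\<gamma> i w t = inv_into (fst (c i)) (snd (c i)) (snd (c i) (x i) + t *\<^sub>R w)" for i w and t :: real
  have "\<exists>D. \<forall>w\<in>E. ((\<lambda>t. h (\<gamma> i w t)) has_vector_derivative D w) (at 0)" if "i < k" for i
  proof -
    obtain U \<phi> where U: "c i = (U, \<phi>)"
      by fastforce
    have "complex_chart X E (U, \<phi>)" "holomorphic_within (h \<circ> inv_into U \<phi>) (\<phi> ` U)" "x i \<in> U"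
      using data c[OF that] U
      by (auto simp: quasi_reflection_data_def complex_manifold_def holomorphic_map_def)
    from holomorphic_has_vector_derivative_along_chart_line[OF E this]
    show ?thesis
      by (simp add: \<gamma>_def U)
  qed
  then obtain D where D: "\<And>i w. i < k \<Longrightarrow> w \<in> E \<Longrightarrow>
      ((\<lambda>t. h (\<gamma> i w t)) has_vector_derivative D i w) (at 0)"
    by metis
  have start: "\<gamma> i w 0 = x i" if "i < k" for i w
  proof -
    have "complex_chart X E (fst (c i), snd (c i))"
      using data c[OF that] by (auto simp: quasi_reflection_data_def complex_manifold_def)
    then have "inj_on (snd (c i)) (fst (c i))"
      by (auto simp: complex_chart_def dest!: homeomorphic_imp_injective_map
          dest: openin_subset simp: topspace_subtopology inj_on_subset Int_absorb1)
    then show ?thesis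
      using c[OF that] by (simp add: \<gamma>_def)
  qed
  have gD: "((\<lambda>t. (g i \<circ> h) (\<gamma> i w t)) has_vector_derivative g i (D i w)) (at 0)"
    if "i < k" "w \<in> E" for i w
  proof -
    have "bounded_linear (g i)"
      using clinear g(1)[OF that(1)] clinear_map_imp_linear linear_conv_bounded_linear by blast
    from bounded_linear.has_vector_derivative[OF this D[OF that]] show ?thesis
      by simp
  qed
  \<comment> \<open>By invariance \<open>\<omega> \<circ> h = \<omega> \<circ> g i \<circ> h\<close>, and all the maps \<open>g i \<circ> h\<close> take the value \<open>v\<close>, so the
    differential of \<open>\<omega> \<circ> h\<close> factors through the same \<open>\<omega>'\<close> in every factor.\<close>
  have \<omega>D: "((\<lambda>t. (\<omega> \<circ> h) (\<gamma> i w t)) has_vector_derivative \<omega>' (g i (D i w))) (at 0)"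
    if "i < k" "w \<in> E" for i w
  proof -
    have "((\<lambda>t. \<omega> ((g i \<circ> h) (\<gamma> i w t))) has_derivative (\<lambda>t. \<omega>' (t *\<^sub>R g i (D i w)))) (at 0)"
      using has_derivative_compose[OF gD[OF that, unfolded has_vector_derivative_def]] der
        g(2)[OF that(1)] start[OF that(1)] by simp
    moreover have "\<omega>' (t *\<^sub>R z) = t *\<^sub>R \<omega>' z" for t z
      using linear_scale[OF has_derivative_linear[OF der]] .
    ultimately show ?thesis
      using orbit_map_invariant[OF \<omega> g(1)[OF that(1)]] by (simp add: has_vector_derivative_def)
  qed
  have "transverse_at E k c (product_map k (\<lambda>_. \<omega> \<circ> h)) x \<longleftrightarrow>
      spans_with_diagonal E k (\<lambda>i w. \<omega>' (g i (D i w)))"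
    using k \<omega>D unfolding \<gamma>_def by (intro transverse_at_iff_spans_with_diagonal) auto
  also have "\<dots> \<longleftrightarrow> inj \<omega>' \<and> spans_with_diagonal E k (\<lambda>i w. g i (D i w))"
    using der has_derivative_linear by (intro spans_with_diagonal_comp_linear[OF k]) blast
  also have "spans_with_diagonal E k (\<lambda>i w. g i (D i w)) \<longleftrightarrow>
      transverse_at E k c (product_map k (\<lambda>i. g i \<circ> h)) x"
    using k gD unfolding \<gamma>_def by (intro transverse_at_iff_spans_with_diagonal[symmetric]) auto
  finally show ?thesis .
qed

section \<open>Normal crossings of quasi-reflection maps\<close>

theorem theorem5p9:
  fixes X :: "'a topology"
    and E :: "(complex^'m) set"
    and A :: "('a, 'm) chart set"
    and H :: "complex^'p \<Rightarrow> complex^'p \<Rightarrow> complex"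
    and G :: "(complex^'p \<Rightarrow> complex^'p) set"
    and \<omega> :: "complex^'p \<Rightarrow> complex^'p"
    and h f :: "'a \<Rightarrow> complex^'p"
  assumes "quasi_reflection_data X E A H G \<omega> h"
    and "f = \<omega> \<circ> h"
  shows "normal_crossings X E A f \<longleftrightarrow>
           orbit_normal_crossings X E A G h \<and> one_to_orbit_over X \<omega> (arrangement H G) h"
proof -
  note data = assms(1) and f = assms(2)
  have H: "pos_def_hermitian H" and G: "reflection_group H G" and \<omega>: "orbit_map G \<omega>"
    and charts: "(\<Union>c\<in>A. fst c) = topspace X"
    using data by (auto simp: quasi_reflection_data_def complex_manifold_def)
  interpret finite_linear_group G
    using reflection_group_finite_linear_group[OF H G] .
  have "polynomial_fun (\<lambda>v. \<omega> v $ i)" for i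
    using \<omega> by (simp add: orbit_map_def invariant_polynomials_def)
  from polynomial_map_has_derivative[OF this]
  obtain W where W: "\<And>v. (\<omega> has_derivative (\<lambda>u. W v *v u)) (at v)"
    by blast
  define \<omega>' where "\<omega>' v = (\<lambda>u. W v *v u)" for v
  have der: "(\<omega> has_derivative \<omega>' v) (at v)" for v
    using W by (simp add: \<omega>'_def)
  show ?thesis
  proof (intro iffI conjI)
    assume nc: "normal_crossings X E A f"
    show "orbit_normal_crossings X E A G h"
      unfolding orbit_normal_crossings_def transverse_to_diagonal_iff
    proof (intro allI impI ballI)
      fix k :: nat and g x c
      assume k: "2 \<le> k" and g: "g \<in> {..<k} \<rightarrow>\<^sub>E G" and x: "x \<in> distinct_tuples (topspace X) k"
        and diag: "product_map k (\<lambda>i. g i \<circ> h) x \<in> small_diagonal UNIV k"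
        and c: "\<forall>i<k. c i \<in> A \<and> x i \<in> fst (c i)"
      define v where "v = g 0 (h (x 0))"
      have gG: "g i \<in> G" if "i < k" for i
        using g that by auto
      have "0 < k"
        using k by simp
      have v: "g i (h (x i)) = v" if "i < k" for i
      proof -
        have "(g i \<circ> h) (x i) = (g 0 \<circ> h) (x 0)"
          using diag that \<open>0 < k\<close> unfolding product_map_in_diagonal_iff by blast
        then show ?thesis
          by (simp add: v_def)
      qed
      have "f (x i) = \<omega> v" if "i < k" for i
        using orbit_map_invariant[OF \<omega> gG[OF that]] v[OF that] by (metis comp_apply f)
      then have "product_map k (\<lambda>_. f) x \<in> small_diagonal UNIV k"
        by (simp add: product_map_in_diagonal_iff)
      then have "transverse_at E k c (product_map k (\<lambda>_. f)) x"
        using nc k x c unfolding normal_crossings_def transverse_to_diagonal_iff by blast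
      moreover have "c i \<in> A \<and> x i \<in> fst (c i)" if "i < k" for i
        using c that by blast
      ultimately show "transverse_at E k c (product_map k (\<lambda>i. g i \<circ> h)) x"
        unfolding f using orbit_map_transverse_at_iff[OF data k _ gG v der] by simp
    qed
    show "one_to_orbit_over X \<omega> (arrangement H G) h"
      unfolding one_to_orbit_over_def
    proof (rule inj_onI, rule ccontr)
      fix x1 x2
      assume x1: "x1 \<in> {x \<in> topspace X. h x \<in> arrangement H G}"
        and x2: "x2 \<in> {x \<in> topspace X. h x \<in> arrangement H G}"
        and eq: "(\<omega> \<circ> h) x1 = (\<omega> \<circ> h) x2" and "x1 \<noteq> x2"
      obtain g' where g': "g' \<in> G" "h x1 = g' (h x2)"
        using orbit_map_separates_orbits[OF \<omega>] eq by (metis comp_apply)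
      \<comment> \<open>Already the transversality of \<open>f \<times> f\<close> at \<open>(x1, x2)\<close> makes the differential of \<open>\<omega>\<close> at
        \<open>h x1\<close> invertible.\<close>
      define x where "x = (\<lambda>i\<in>{..<2 :: nat}. if i = 0 then x1 else x2)"
      define g where "g i = (if i = 0 then id else g')" for i :: nat
      obtain c1 c2 where c12: "c1 \<in> A" "x1 \<in> fst c1" "c2 \<in> A" "x2 \<in> fst c2"
        using x1 x2 charts by (metis (no_types, lifting) UN_E mem_Collect_eq)
      define c where "c i = (if i = 0 then c1 else c2)" for i :: nat
      have c: "c i \<in> A \<and> x i \<in> fst (c i)" if "i < 2" for i
        using c12 that by (simp add: c_def x_def)
      have g: "g i \<in> G" "g i (h (x i)) = h x1" if "i < 2" for i
        using g' id_mem that by (simp_all add: g_def x_def)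
      have "x \<in> distinct_tuples (topspace X) 2"
        using x1 x2 \<open>x1 \<noteq> x2\<close> by (auto simp: x_def distinct_tuples_def)
      moreover have "product_map 2 (\<lambda>_. f) x \<in> small_diagonal UNIV 2"
        using eq f by (simp add: product_map_in_diagonal_iff x_def)
      ultimately have "transverse_at E 2 c (product_map 2 (\<lambda>_. f)) x"
        using nc c unfolding normal_crossings_def transverse_to_diagonal_iff by blast
      then have "inj (\<omega>' (h x1))"
        unfolding f using orbit_map_transverse_at_iff[OF data order_refl c g der] by simp
      then show False
        using orbit_map_derivative_not_injective_on_arrangement[OF H G \<omega> _ der] x1 by blast
    qed
  next
    assume "orbit_normal_crossings X E A G h \<and> one_to_orbit_over X \<omega> (arrangement H G) h"
    then have onc: "orbit_normal_crossings X E A G h"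
      and oto: "one_to_orbit_over X \<omega> (arrangement H G) h"
      by blast+
    show "normal_crossings X E A f"
      unfolding normal_crossings_def transverse_to_diagonal_iff
    proof (intro allI impI ballI)
      fix k :: nat and x c
      assume k: "2 \<le> k" and x: "x \<in> distinct_tuples (topspace X) k"
        and diag: "product_map k (\<lambda>_. f) x \<in> small_diagonal UNIV k"
        and c: "\<forall>i<k. c i \<in> A \<and> x i \<in> fst (c i)"
      have same: "\<omega> (h (x i)) = \<omega> (h (x j))" if "i < k" "j < k" for i j
      proof -
        have "f (x i) = f (x j)"
          using diag that unfolding product_map_in_diagonal_iff by blast
        then show ?thesis
          by (simp add: f)
      qed
      define v where "v = h (x 0)"
      have "\<exists>g\<in>G. g (h (x i)) = v" if "i < k" for i
        using orbit_map_separates_orbits[OF \<omega> same[OF _ that, of 0]] k v_def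
        by (metis less_le_trans pos2)
      then obtain g0 where g0: "\<And>i. i < k \<Longrightarrow> g0 i \<in> G" "\<And>i. i < k \<Longrightarrow> g0 i (h (x i)) = v"
        by metis
      \<comment> \<open>Orbit normal crossings quantifies over extensional tuples of group elements.\<close>
      define g where "g = restrict g0 {..<k}"
      have g: "g i \<in> G" "g i (h (x i)) = v" if "i < k" for i
        using g0 that by (simp_all add: g_def)
      \<comment> \<open>The arrangement is a union of orbits, so with \<open>h (x 0)\<close> it would also contain \<open>h (x 1)\<close>.\<close>
      have "v \<notin> arrangement H G"
      proof
        assume v: "v \<in> arrangement H G"
        have "1 < k"
          using k by simp
        obtain g' where g': "g' \<in> G" "h (x 1) = g' v"
          using orbit_map_separates_orbits[OF \<omega> same[OF \<open>1 < k\<close>, of 0]] \<open>1 < k\<close> v_def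
          by (metis less_trans zero_less_one)
        have "h (x 1) \<in> arrangement H G"
          using arrangement_invariant[OF H G g'(1) v] g'(2) by simp
        moreover have "x 0 \<in> topspace X" "x 1 \<in> topspace X" "x 0 \<noteq> x 1"
          using x \<open>1 < k\<close> by (auto simp: distinct_tuples_def)
        ultimately show False
          using oto v same[of 0 1] \<open>1 < k\<close> unfolding one_to_orbit_over_def v_def inj_on_def by auto
      qed
      then have "inj (\<omega>' v)"
        using orbit_map_derivative_injective_off_arrangement[OF H G \<omega> _ der] by blast
      have "product_map k (\<lambda>i. g i \<circ> h) x \<in> small_diagonal UNIV k"
        using g by (simp add: product_map_in_diagonal_iff)
      moreover have "g \<in> {..<k} \<rightarrow>\<^sub>E G"
        using g0(1) by (simp add: g_def)
      ultimately have "transverse_at E k c (product_map k (\<lambda>i. g i \<circ> h)) x"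
        using onc k x c unfolding orbit_normal_crossings_def transverse_to_diagonal_iff by blast
      moreover have "c i \<in> A \<and> x i \<in> fst (c i)" if "i < k" for i
        using c that by blast
      ultimately show "transverse_at E k c (product_map k (\<lambda>_. f)) x"
        using \<open>inj (\<omega>' v)\<close>
        unfolding f using orbit_map_transverse_at_iff[OF data k _ g der] by simp
    qed
  qed
qed

end
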